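(* Let $(X,d)$ be a $\delta$-hyperbolic space and $\Gamma$ a group acting properly by isometries on $X$, with $\operatorname{diam}(\Gamma\backslash X)\le D$ and $\operatorname{Ent}(X,d)\le H$. Then for every $x\in X$ and every $R\ge 10(D+2\delta)$, $$\frac{\#\{\gamma\in\Gamma:d(x,\gamma x)<2R\}}{\#\{\gamma\in\Gamma:d(x,\gamma x)<R\}}\ \le\ 3^4e^{\frac{13}{2}HR}.$$
   Context: A $\delta$-hyperbolic space is a geodesic proper metric space all of whose geodesic triangles are $\delta$-thin (for a triangle $\Delta$ with vertices $x,y,z$, its tripod $T_\Delta$ has edges of lengths $(y|z)_x,(x|z)_y,(x|y)_z$ where $(y|z)_x=\frac12(d(x,y)+d(x,z)-d(y,z))$; the map $f_\Delta:\Delta\to T_\Delta$ is isometric on each side and sends vertices to ends; $\delta$-thin means $f_\Delta(u)=f_\Delta(v)\Rightarrow d(u,v)\le\delta$). A proper action: $\{\gamma: d(x,\gamma x)\le R\}$ finite for all $x,R$. $\Gamma\backslash X$ carries the quotient distance $\bar d(\Gamma x,\Gamma y)=\inf_\gamma d(x,\gamma y)$. $\operatorname{Ent}(X,d)=\liminf_{R\to\infty}\frac1R\ln\#\{\gamma\in\Gamma:d(x,\gamma x)<R\}$. *)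

theory Defs
  imports "HOL-Analysis.Analysis"
begin

definition gromov_product :: "'a::metric_space \<Rightarrow> 'a \<Rightarrow> 'a \<Rightarrow> real" where
  "gromov_product y z x = (dist x y + dist x z - dist y z) / 2"

definition geodesic_seg :: "(real \<Rightarrow> 'a::metric_space) \<Rightarrow> 'a \<Rightarrow> 'a \<Rightarrow> bool" where
  "geodesic_seg c x y \<longleftrightarrow> c 0 = x \<and> c (dist x y) = y \<and>
     (\<forall>s\<in>{0..dist x y}. \<forall>t\<in>{0..dist x y}. dist (c s) (c t) = \<bar>s - t\<bar>)"

definition geodesic_space :: "'a::metric_space itself \<Rightarrow> bool" where
  "geodesic_space _ \<longleftrightarrow> (\<forall>x y::'a. \<exists>c. geodesic_seg c x y)"

definition proper_space :: "'a::metric_space itself \<Rightarrow> bool" where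
  "proper_space _ \<longleftrightarrow> (\<forall>(x::'a) r. compact (cball x r))"

(* The geodesic triangle with sides c1:[x,y], c2:[x,z], c3:[y,z] is delta-thin:
   points with the same image under the tripod map are at distance at most delta.
   Points on one side are identified only with themselves (isometry on each side),
   so only pairs on different sides near a common vertex need checking. *)
definition thin_triangle :: "real \<Rightarrow> 'a::metric_space \<Rightarrow> 'a \<Rightarrow> 'a \<Rightarrow>
    (real \<Rightarrow> 'a) \<Rightarrow> (real \<Rightarrow> 'a) \<Rightarrow> (real \<Rightarrow> 'a) \<Rightarrow> bool" where
  "thin_triangle \<delta> x y z c1 c2 c3 \<longleftrightarrow>
     (\<forall>t\<in>{0..gromov_product y z x}. dist (c1 t) (c2 t) \<le> \<delta>) \<and>
     (\<forall>t\<in>{0..gromov_product x z y}. dist (c1 (dist x y - t)) (c3 t) \<le> \<delta>) \<and>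
     (\<forall>t\<in>{0..gromov_product x y z}. dist (c2 (dist x z - t)) (c3 (dist y z - t)) \<le> \<delta>)"

definition hyperbolic_space :: "real \<Rightarrow> 'a::metric_space itself \<Rightarrow> bool" where
  "hyperbolic_space \<delta> T \<longleftrightarrow> geodesic_space T \<and> proper_space T \<and>
     (\<forall>x y z::'a. \<forall>c1 c2 c3. geodesic_seg c1 x y \<longrightarrow> geodesic_seg c2 x z \<longrightarrow>
        geodesic_seg c3 y z \<longrightarrow> thin_triangle \<delta> x y z c1 c2 c3)"

definition isometric_action :: "('g::group_add \<Rightarrow> 'a::metric_space \<Rightarrow> 'a) \<Rightarrow> bool" where
  "isometric_action act \<longleftrightarrow> (\<forall>x. act 0 x = x) \<and> (\<forall>g h x. act (g + h) x = act g (act h x)) \<and>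
     (\<forall>g x y. dist (act g x) (act g y) = dist x y)"

definition proper_action :: "('g \<Rightarrow> 'a::metric_space \<Rightarrow> 'a) \<Rightarrow> bool" where
  "proper_action act \<longleftrightarrow> (\<forall>x R. finite {g. dist x (act g x) \<le> R})"

definition quot_dist :: "('g \<Rightarrow> 'a::metric_space \<Rightarrow> 'a) \<Rightarrow> 'a \<Rightarrow> 'a \<Rightarrow> real" where
  "quot_dist act x y = (INF g. dist x (act g y))"

definition quot_diam_le :: "('g \<Rightarrow> 'a::metric_space \<Rightarrow> 'a) \<Rightarrow> real \<Rightarrow> bool" where
  "quot_diam_le act D \<longleftrightarrow> (\<forall>x y. quot_dist act x y \<le> D)"

definition orbit_count :: "('g \<Rightarrow> 'a::metric_space \<Rightarrow> 'a) \<Rightarrow> 'a \<Rightarrow> real \<Rightarrow> nat" where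
  "orbit_count act x R = card {g. dist x (act g x) < R}"

definition entropy :: "('g \<Rightarrow> 'a::metric_space \<Rightarrow> 'a) \<Rightarrow> 'a \<Rightarrow> ereal" where
  "entropy act x = Liminf at_top (\<lambda>R. ereal (ln (real (orbit_count act x R)) / R))"

end

theory Submission
  imports Defs
begin

text \<open>
  Write \<open>|g| = d(x, gx)\<close> and \<open>N(R)\<close> for the orbit count at \<open>x\<close>. By thinness, the elements \<open>s\<close> with
  \<open>|s| < M\<close> whose Gromov product with a fixed point is at least \<open>t\<close> all pass \<open>\<delta>\<close>-close to one point
  at distance \<open>t\<close> from \<open>x\<close>, so there are at most \<open>N(M - t + D + \<delta>)\<close> of them; for
  \<open>M + D + \<delta> \<le> 3L/2\<close> and \<open>t = L/2\<close> this is at most \<open>N(L)\<close>. Multiply an arbitrary \<open>g\<close> by those \<open>s\<close> with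
  \<open>L \<le> |s| < M\<close> for which \<open>(g\<^sup>-\<^sup>1 x | s x) < L/2\<close>: at most \<open>N(L)\<close> choices of \<open>s\<close> are excluded, and since
  then \<open>(s\<^sup>-\<^sup>1 x | (gs)\<^sup>-\<^sup>1 x) > L/2\<close>, each product arises at most \<open>N(L)\<close> times. Hence \<open>N\<close> grows by the
  factor \<open>N(M)/N(L) - 2\<close> per step of length \<open>M\<close>, and the entropy bound gives
  \<open>N(M) \<le> 3 exp(HM) N(L)\<close>. Three such steps, \<open>R\<close>, \<open>7R/5\<close>, \<open>49R/25\<close>, \<open>2R\<close>, suffice.
\<close>

section \<open>Isometric actions, orbit balls and the quotient diameter\<close>

lemma isometric_action_zero: "isometric_action act \<Longrightarrow> act 0 x = x"
  and isometric_action_add: "isometric_action act \<Longrightarrow> act (g + h) x = act g (act h x)"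
  and isometric_action_dist: "isometric_action act \<Longrightarrow> dist (act g x) (act g y) = dist x y"
  by (auto simp: isometric_action_def)

lemma isometric_action_minus_cancel:
  assumes "isometric_action act"
  shows "act (- g) (act g x) = x"
  using isometric_action_add[OF assms, of "- g" g x] isometric_action_zero[OF assms] by simp

lemma isometric_action_dist_swap:
  assumes "isometric_action act"
  shows "dist (act (- g) x) y = dist x (act g y)"
  by (metis isometric_action_dist[OF assms] isometric_action_minus_cancel[OF assms])

lemma finite_orbit_ball:
  assumes "proper_action act"
  shows "finite {g. dist x (act g x) < R}"
proof (rule finite_subset)
  show "finite {g. dist x (act g x) \<le> R}"
    using assms by (simp add: proper_action_def)
qed auto

lemma orbit_count_mono:
  assumes "proper_action act" "R \<le> R'"
  shows "orbit_count act x R \<le> orbit_count act x R'"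
  unfolding orbit_count_def
  by (rule card_mono) (use assms finite_orbit_ball in auto)

lemma orbit_count_pos:
  assumes "isometric_action act" "proper_action act" "0 < R"
  shows "1 \<le> orbit_count act x R"
proof -
  have "0 \<in> {g. dist x (act g x) < R}"
    using assms by (simp add: isometric_action_zero)
  then show ?thesis
    unfolding orbit_count_def
    using finite_orbit_ball[OF assms(2)] by (metis Suc_leI One_nat_def card_gt_0_iff empty_iff)
qed

lemma hyperbolic_space_nonneg:
  assumes "hyperbolic_space \<delta> TYPE('a::metric_space)"
  shows "0 \<le> \<delta>"
proof -
  fix x :: 'a
  obtain c where "geodesic_seg c x x"
    using assms unfolding hyperbolic_space_def geodesic_space_def by blast
  then have "thin_triangle \<delta> x x x c c c"
    using assms unfolding hyperbolic_space_def by blast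
  then show ?thesis
    by (auto simp: thin_triangle_def gromov_product_def)
qed

lemma quot_diam_le_nonneg:
  assumes "quot_diam_le act D"
  shows "0 \<le> D"
proof -
  fix x
  have "0 \<le> quot_dist act x x"
    unfolding quot_dist_def by (rule cINF_greatest) auto
  then show ?thesis
    using assms by (meson order_trans quot_diam_le_def)
qed

text \<open>Properness of the action makes the infimum in the quotient distance a minimum.\<close>

lemma quot_diam_le_attained:
  assumes "proper_action act" "quot_diam_le act D"
  obtains g where "dist v (act g x) \<le> D"
proof -
  \<comment> \<open>The slack 1 makes \<open>A\<close> nonempty and properness makes it finite. A
    minimiser at distance more than \<open>D\<close> would be beaten by some \<open>h\<close>, again
    in \<open>A\<close>.\<close>
  define A where "A = {g. dist v (act g x) < D + 1}"
  have inf: "(INF g. dist v (act g x)) \<le> D"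
    using assms(2) by (auto simp: quot_diam_le_def quot_dist_def)
  have bdd: "bdd_below (range (\<lambda>g. dist v (act g x)))"
    by (rule bdd_belowI[of _ 0]) auto
  have near: "\<exists>g. dist v (act g x) < e" if "D < e" for e
    using inf that cINF_less_iff[OF UNIV_not_empty bdd, of e] by auto
  have "finite A"
  proof (rule finite_subset)
    show "A \<subseteq> {g. dist x (act g x) \<le> dist x v + (D + 1)}"
    proof
      fix g assume "g \<in> A"
      then show "g \<in> {g. dist x (act g x) \<le> dist x v + (D + 1)}"
        using dist_triangle[of x "act g x" v] by (simp add: A_def)
    qed
    show "finite {g. dist x (act g x) \<le> dist x v + (D + 1)}"
      using assms(1) by (simp add: proper_action_def)
  qed
  have "A \<noteq> {}"
    using near[of "D + 1"] by (auto simp: A_def)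
  define g where "g = arg_min_on (\<lambda>g. dist v (act g x)) A"
  have g: "g \<in> A" "\<And>h. h \<in> A \<Longrightarrow> dist v (act g x) \<le> dist v (act h x)"
    using arg_min_if_finite(1)[OF \<open>finite A\<close> \<open>A \<noteq> {}\<close>, of "\<lambda>g. dist v (act g x)"]
      arg_min_least[OF \<open>finite A\<close> \<open>A \<noteq> {}\<close>, of _ "\<lambda>g. dist v (act g x)"]
    by (auto simp: g_def)
  have "dist v (act g x) \<le> D"
  proof (rule ccontr)
    assume "\<not> ?thesis"
    then obtain h where h: "dist v (act h x) < dist v (act g x)"
      using near[of "dist v (act g x)"] by auto
    with g(1) have "h \<in> A"
      by (auto simp: A_def)
    with g(2) h show False
      by (meson not_le)
  qed
  then show ?thesis by (rule that)
qed

section \<open>Counting orbit points by Gromov products\<close>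

text \<open>Fix a geodesic \<open>c\<close> from \<open>x\<close> to \<open>p\<close> and an orbit
  point \<open>act g x\<close> within \<open>D\<close> of \<open>c t\<close>. Each counted
  \<open>act s x\<close> lies at distance less than \<open>M - t\<close> from a point within
  \<open>\<delta>\<close> of \<open>c t\<close>, so left translation by \<open>- g\<close> embeds
  the set into one orbit ball.\<close>

lemma card_large_gromov_product_le:
  fixes act :: "'g::group_add \<Rightarrow> 'a::metric_space \<Rightarrow> 'a"
  assumes hyp: "hyperbolic_space \<delta> TYPE('a)"
    and iso: "isometric_action act" and proper: "proper_action act" and diam: "quot_diam_le act D"
    and t: "0 \<le> t"
  shows "card {s. dist x (act s x) < M \<and> t \<le> gromov_product (act s x) p x}
           \<le> orbit_count act x (M - t + (D + \<delta>))"
proof (cases "t \<le> dist x p")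
  case True
  obtain c where c: "geodesic_seg c x p"
    using hyp unfolding hyperbolic_space_def geodesic_space_def by blast
  obtain g where g: "dist (c t) (act g x) \<le> D"
    using quot_diam_le_attained[OF proper diam] .
  have "dist x (act (- g + s) x) < M - t + (D + \<delta>)"
    if s: "dist x (act s x) < M" "t \<le> gromov_product (act s x) p x" for s
  proof -
    obtain b where b: "geodesic_seg b x (act s x)"
      using hyp unfolding hyperbolic_space_def geodesic_space_def by blast
    obtain e where e: "geodesic_seg e (act s x) p"
      using hyp unfolding hyperbolic_space_def geodesic_space_def by blast
    have "thin_triangle \<delta> x (act s x) p b c e"
      using hyp b c e unfolding hyperbolic_space_def by blast
    then have fellow: "dist (b t) (c t) \<le> \<delta>"
      using s(2) t unfolding thin_triangle_def by auto
    have "t \<le> dist x (act s x)"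
      using s(2) dist_triangle[of x p "act s x"] by (simp add: gromov_product_def)
    then have "dist (b (dist x (act s x))) (b t) = \<bar>dist x (act s x) - t\<bar>"
      using b t unfolding geodesic_seg_def by (meson atLeastAtMost_iff order_refl zero_le_dist)
    moreover have "b (dist x (act s x)) = act s x"
      using b unfolding geodesic_seg_def by blast
    ultimately have "dist (act s x) (b t) = dist x (act s x) - t"
      using \<open>t \<le> dist x (act s x)\<close> by (metis abs_of_nonneg diff_ge_0_iff_ge)
    then have "dist (act g x) (act s x) < M - t + (D + \<delta>)"
      using g s(1) fellow dist_triangle[of "act g x" "act s x" "c t"]
        dist_triangle[of "c t" "act s x" "b t"]
      by (simp add: dist_commute)
    then show ?thesis
      using isometric_action_dist_swap[OF iso, of "- g" x "act s x"]
      by (simp add: isometric_action_add[OF iso])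
  qed
  then have "(+) (- g) ` {s. dist x (act s x) < M \<and> t \<le> gromov_product (act s x) p x}
      \<subseteq> {h. dist x (act h x) < M - t + (D + \<delta>)}"
    by auto
  then show ?thesis
    unfolding orbit_count_def
    by (intro card_inj_on_le[of "(+) (- g)"] finite_orbit_ball[OF proper]) (auto simp: inj_on_def)
next
  case False
  \<comment> \<open>Any Gromov product with \<open>p\<close> at \<open>x\<close> is at most
    \<open>dist x p\<close>, so here the set is empty.\<close>
  have "gromov_product y p x < t" for y :: 'a
    using False dist_triangle[of x y p] by (simp add: gromov_product_def dist_commute)
  then have "{s. dist x (act s x) < M \<and> t \<le> gromov_product (act s x) p x} = {}"
    by (simp add: not_le[symmetric])
  then show ?thesis
    by (metis card.empty le0)
qed

lemma orbit_count_add_ge: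
  fixes act :: "'g::group_add \<Rightarrow> 'a::metric_space \<Rightarrow> 'a"
  assumes hyp: "hyperbolic_space \<delta> TYPE('a)"
    and iso: "isometric_action act" and proper: "proper_action act" and diam: "quot_diam_le act D"
    and L: "0 \<le> L" and LM: "L \<le> M" and M: "M + (D + \<delta>) \<le> 3 / 2 * L"
  shows "orbit_count act x T * (orbit_count act x M - 2 * orbit_count act x L)
           \<le> orbit_count act x (T + M) * orbit_count act x L"
proof -
  define N where "N = orbit_count act x"
  define B where "B R = {g. dist x (act g x) < R}" for R
  define far where
    "far g = {s \<in> B M - B L. gromov_product (act (- g) x) (act s x) x < L / 2}" for g
  define P where "P = (SIGMA g:B T. far g)"
  have finB: "finite (B R)" and cardB: "card (B R) = N R" for R
    by (simp_all add: B_def N_def finite_orbit_ball[OF proper] orbit_count_def)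
  \<comment> \<open>The hypothesis \<open>M\<close> amounts to
    \<open>M - L / 2 + (D + \<delta>) \<le> L\<close>, so the ball at \<open>t = L / 2\<close> has
    radius at most \<open>L\<close>.\<close>
  have near_card:
    "card {s. dist x (act s x) < M \<and> L / 2 \<le> gromov_product (act s x) p x} \<le> N L" for p
    using card_large_gromov_product_le[OF hyp iso proper diam, of "L / 2" x M p]
      orbit_count_mono[OF proper, of "M - L / 2 + (D + \<delta>)" L x] L M
    by (simp add: N_def)
  have sub: "B L \<subseteq> B M"
    using LM by (auto simp: B_def)
  have fin_far: "finite (far g)" for g
    using finB by (auto simp: far_def)
  \<comment> \<open>Subtraction of naturals truncates, so the bound is trivial if
    \<open>N M < 2 * N L\<close>.\<close>
  have far_card: "N M - 2 * N L \<le> card (far g)" for g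
  proof -
    let ?C = "{s. dist x (act s x) < M \<and> L / 2 \<le> gromov_product (act s x) (act (- g) x) x}"
    have finC: "finite ?C"
      by (rule finite_subset[OF _ finB[of M]]) (auto simp: B_def)
    have "B M \<subseteq> far g \<union> (B L \<union> ?C)"
      by (auto simp: far_def B_def gromov_product_def dist_commute algebra_simps not_le)
    then have "card (B M) \<le> card (far g \<union> (B L \<union> ?C))"
      by (intro card_mono) (use finB fin_far finC in auto)
    also have "\<dots> \<le> card (far g) + (card (B L) + card ?C)"
      by (meson add_left_mono card_Un_le order_trans)
    finally show ?thesis
      using near_card[of "act (- g) x"] cardB by simp
  qed
  have prod_in: "(\<lambda>(g, s). g + s) ` P \<subseteq> B (T + M)"
  proof clarify
    fix g s assume "(g, s) \<in> P"
    then have "dist x (act g x) < T" "dist x (act s x) < M"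
      by (auto simp: P_def far_def B_def)
    then show "g + s \<in> B (T + M)"
      using dist_triangle[of x "act g (act s x)" "act g x"]
      by (simp add: B_def isometric_action_add[OF iso] isometric_action_dist[OF iso])
  qed
  have fibre: "card {p \<in> P. (\<lambda>(g, s). g + s) p = h} \<le> N L" for h
  proof -
    let ?C = "{s. dist x (act s x) < M \<and> L / 2 \<le> gromov_product (act s x) (act (- h) x) x}"
    \<comment> \<open>With \<open>h = g + s\<close>, the products of \<open>act (- s) x\<close> with
      \<open>act (- h) x\<close> and of \<open>act (- g) x\<close> with \<open>act s x\<close> add
      up to \<open>dist x (act s x) \<ge> L\<close>. The second is below \<open>L / 2\<close>, so
      the first exceeds it.\<close>
    have "(\<lambda>(g, s). - s) ` {p \<in> P. (\<lambda>(g, s). g + s) p = h} \<subseteq> ?C"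
    proof
      fix r assume "r \<in> (\<lambda>(g, s). - s) ` {p \<in> P. (\<lambda>(g, s). g + s) p = h}"
      then obtain g s where gs: "(g, s) \<in> P" and h: "h = g + s" and r: "r = - s"
        by auto
      from gs have s: "dist x (act s x) < M" "L \<le> dist x (act s x)"
        "gromov_product (act (- g) x) (act s x) x < L / 2"
        by (auto simp: P_def far_def B_def)
      have 1: "dist x (act (- y) x) = dist x (act y x)" for y
        using isometric_action_dist_swap[OF iso, of y x x] by (simp add: dist_commute)
      have 2: "dist (act (- g) x) (act s x) = dist x (act h x)"
        by (simp add: h isometric_action_dist_swap[OF iso] isometric_action_add[OF iso])
      have minus_h: "- h = - s + - g"
        unfolding h by (rule minus_add)
      have 3: "dist (act (- s) x) (act (- h) x) = dist x (act g x)"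
        unfolding minus_h isometric_action_add[OF iso] isometric_action_dist[OF iso] 1 ..
      show "r \<in> ?C"
        using s by (simp add: r gromov_product_def 1 2 3)
    qed
    moreover have "inj_on (\<lambda>(g, s). - s) {p \<in> P. (\<lambda>(g, s). g + s) p = h}"
      by (auto simp: inj_on_def)
    moreover have "finite ?C"
      by (rule finite_subset[OF _ finB[of M]]) (auto simp: B_def)
    ultimately have "card {p \<in> P. (\<lambda>(g, s). g + s) p = h} \<le> card ?C"
      by (metis (no_types, lifting) card_inj_on_le)
    then show ?thesis
      using near_card[of "act (- h) x"] by linarith
  qed
  have finP: "finite P"
    unfolding P_def using finB fin_far by auto
  have "N T * (N M - 2 * N L) \<le> (\<Sum>g\<in>B T. card (far g))"
    using sum_mono[of "B T" "\<lambda>_. N M - 2 * N L" "\<lambda>g. card (far g)"] far_card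
    by (simp add: cardB)
  also have "\<dots> = card P"
    unfolding P_def using finB fin_far by simp
  \<comment> \<open>Double counting: the pairs are regrouped by their product.\<close>
  also have "\<dots> = (\<Sum>h\<in>B (T + M). card {p \<in> P. (\<lambda>(g, s). g + s) p = h})"
    using sum.group[OF finP finB prod_in, of "\<lambda>_. 1::nat"] by simp
  also have "\<dots> \<le> N (T + M) * N L"
    using sum_mono[of "B (T + M)" _ "\<lambda>_. N L", OF fibre] by (simp add: cardB)
  finally show ?thesis
    by (simp add: N_def)
qed

section \<open>From growth along a progression of radii to entropy\<close>

text \<open>Monotonicity extends the growth from the radii \<open>M + real n * M\<close> to all
  \<open>R \<ge> M\<close>, at the cost of an error \<open>2 * ln q / R\<close> that vanishes in the
  limit.\<close>

lemma entropy_ge: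
  assumes proper: "proper_action act" and M: "0 < M" and q: "1 \<le> q"
    and growth: "\<And>n. q ^ n \<le> real (orbit_count act x (M + real n * M))"
  shows "ereal (ln q / M) \<le> entropy act x"
proof -
  have ge: "ln q / M - 2 * ln q / R \<le> ln (real (orbit_count act x R)) / R" if R: "M \<le> R" for R
  proof -
    \<comment> \<open>The largest \<open>n\<close> with \<open>M + real n * M \<le> R\<close>; the
      assumption \<open>M \<le> R\<close> keeps it from being truncated.\<close>
    define n where "n = nat (\<lfloor>R / M\<rfloor> - 1)"
    have "1 \<le> \<lfloor>R / M\<rfloor>"
      using R M by (simp add: le_floor_iff)
    then have n: "real n + 1 \<le> R / M" "R / M - 2 \<le> real n"
      unfolding n_def by linarith+
    then have "M + real n * M \<le> R"
      using M by (simp add: field_simps)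
    then have le: "q ^ n \<le> real (orbit_count act x R)"
      using growth[of n] orbit_count_mono[OF proper] of_nat_mono order_trans by blast
    have "(R / M - 2) * ln q \<le> real n * ln q"
      using n(2) q by (intro mult_right_mono) auto
    also have "\<dots> = ln (q ^ n)"
      using q by (simp add: ln_realpow)
    also have "\<dots> \<le> ln (real (orbit_count act x R))"
      using le q by (smt (verit) ln_le_cancel_iff zero_less_power)
    finally have "(R / M - 2) * ln q / R \<le> ln (real (orbit_count act x R)) / R"
      using R M by (intro divide_right_mono) auto
    moreover have "(R / M - 2) * ln q / R = ln q / M - 2 * ln q / R"
      using R M by (simp add: field_simps)
    ultimately show ?thesis by simp
  qed
  have "((\<lambda>R. ln q / M - 2 * ln q / R) \<longlongrightarrow> ln q / M - 0) at_top"
    by (intro tendsto_diff tendsto_const tendsto_divide_0[OF tendsto_const])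
      (simp add: filterlim_at_top_imp_at_infinity filterlim_ident)
  then have "((\<lambda>R. ereal (ln q / M - 2 * ln q / R)) \<longlongrightarrow> ereal (ln q / M)) at_top"
    by simp
  then have "ereal (ln q / M) = Liminf at_top (\<lambda>R. ereal (ln q / M - 2 * ln q / R))"
    by (intro lim_imp_Liminf[symmetric]) auto
  also have "\<dots> \<le> entropy act x"
    unfolding entropy_def
    by (intro Liminf_mono eventually_mono[OF eventually_ge_at_top[of M]]) (simp add: ge)
  finally show ?thesis .
qed

text \<open>The case \<open>q = 1\<close>: every ball of positive radius counts the identity. This
  makes \<open>H\<close> nonnegative later.\<close>

lemma entropy_nonneg:
  assumes "isometric_action act" "proper_action act"
  shows "0 \<le> entropy act x"
  using entropy_ge[OF assms(2), of 1 1 x] orbit_count_pos[OF assms]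
  by (simp add: zero_ereal_def add_pos_nonneg)

text \<open>Iterating the product bound gives growth by \<open>q\<close> per step of length
  \<open>M\<close>, hence \<open>ln q \<le> H * M\<close>. The 2 subtracted in \<open>q\<close> is
  absorbed by \<open>2 * exp (H * M)\<close>, which gives the factor 3.\<close>

lemma orbit_count_le_exp_entropy:
  fixes act :: "'g::group_add \<Rightarrow> 'a::metric_space \<Rightarrow> 'a"
  assumes hyp: "hyperbolic_space \<delta> TYPE('a)"
    and iso: "isometric_action act" and proper: "proper_action act" and diam: "quot_diam_le act D"
    and ent: "entropy act x \<le> ereal H"
    and L: "0 < L" and LM: "L \<le> M" and M: "M + (D + \<delta>) \<le> 3 / 2 * L"
  shows "real (orbit_count act x M) \<le> 3 * exp (H * M) * real (orbit_count act x L)"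
proof -
  define a where "a = real (orbit_count act x L)"
  define q where "q = real (orbit_count act x M) / a - 2"
  have a: "1 \<le> a"
    unfolding a_def using orbit_count_pos[OF iso proper L] by simp
  have "0 \<le> ereal H"
    using entropy_nonneg[OF iso proper] ent by (rule order_trans)
  then have H: "0 \<le> H" by simp
  have "q \<le> exp (H * M)"
  proof (cases "1 \<le> q")
    case True
    have step: "real (orbit_count act x T) * q \<le> real (orbit_count act x (T + M))" for T
    proof -
      have "real (orbit_count act x M) - 2 * a
          \<le> real (orbit_count act x M - 2 * orbit_count act x L)"
        by (simp add: a_def)
      then have "real (orbit_count act x T) * (real (orbit_count act x M) - 2 * a)
          \<le> real (orbit_count act x T) * real (orbit_count act x M - 2 * orbit_count act x L)"
        by (intro mult_left_mono) auto
      also have "\<dots> \<le> real (orbit_count act x (T + M)) * a"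
        using orbit_count_add_ge[OF hyp iso proper diam less_imp_le[OF L] LM M, of x T]
        by (metis a_def of_nat_mono of_nat_mult)
      finally show ?thesis
        using a by (simp add: q_def field_simps)
    qed
    have "q ^ n \<le> real (orbit_count act x (M + real n * M))" for n
    proof (induction n)
      case 0
      show ?case
        using orbit_count_pos[OF iso proper, of M x] L LM by simp
    next
      case (Suc n)
      then have "q ^ Suc n \<le> real (orbit_count act x (M + real n * M)) * q"
        using True by (simp add: mult.commute)
      also have "\<dots> \<le> real (orbit_count act x (M + real n * M + M))"
        by (rule step)
      finally show ?case
        by (simp add: algebra_simps)
    qed
    then have "ereal (ln q / M) \<le> ereal H"
      using entropy_ge[OF proper _ True] L LM ent by (meson less_le_trans order_trans)
    then have "ln q \<le> H * M"
      using L LM by (simp add: field_simps)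
    then show ?thesis
      using True by (metis exp_le_cancel_iff exp_ln less_le_trans zero_less_one)
  next
    case False
    moreover have "1 \<le> exp (H * M)"
      using H L LM by simp
    ultimately show ?thesis by linarith
  qed
  moreover have "1 \<le> exp (H * M)"
    using H L LM by simp
  ultimately have "q + 2 \<le> 3 * exp (H * M)"
    by linarith
  then have "real (orbit_count act x M) / a \<le> 3 * exp (H * M)"
    by (simp add: q_def)
  then show ?thesis
    using a by (simp add: a_def field_simps)
qed

theorem theorem5p1:
  fixes act :: "'g::group_add \<Rightarrow> 'a::metric_space \<Rightarrow> 'a"
    and \<delta> D H R :: real and x :: 'a
  assumes "hyperbolic_space \<delta> TYPE('a)"
    and "isometric_action act"
    and "proper_action act"
    and "quot_diam_le act D"
    and "\<forall>y. entropy act y \<le> ereal H"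
    and "R \<ge> 10 * (D + 2 * \<delta>)"
  shows "real (orbit_count act x (2 * R)) / real (orbit_count act x R)
           \<le> 3 ^ 4 * exp (13 / 2 * H * R)"
proof -
  note \<delta> = hyperbolic_space_nonneg[OF assms(1)] and D = quot_diam_le_nonneg[OF assms(4)]
  have ent: "entropy act x \<le> ereal H"
    using assms(5) by simp
  have "0 \<le> ereal H"
    using entropy_nonneg[OF assms(2,3)] ent by (rule order_trans)
  then have H: "0 \<le> H" by simp
  define N where "N r = real (orbit_count act x r)" for r
  show ?thesis
  \<comment> \<open>\<open>R = 0\<close> is possible when \<open>D\<close> and
    \<open>\<delta>\<close> vanish; both strict balls are then empty and the quotient is
    \<open>0 / 0 = 0\<close>.\<close>
  proof (cases "R = 0")
    case True
    then show ?thesis by (simp add: orbit_count_def)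
  next
    case False
    have DR: "10 * D + 20 * \<delta> \<le> R"
      using assms(6) by simp
    with False have R: "0 < R"
      using \<delta> D by linarith
    \<comment> \<open>Since \<open>D + \<delta> \<le> R / 10 \<le> L / 10\<close>, the ratio 7/5
      leaves exactly the room needed: 7/5 + 1/10 = 3/2.\<close>
    have step: "N M \<le> 3 * exp (H * M) * N L" if "R \<le> L" "L \<le> M" "M \<le> 7 / 5 * L" for L M
      unfolding N_def
      by (rule orbit_count_le_exp_entropy[OF assms(1-4) ent]) (use that R \<delta> D DR in linarith)+
    have "N (2 * R) \<le> 3 * exp (H * (2 * R)) * N (49 / 25 * R)"
      using R by (intro step) auto
    also have "\<dots> \<le> 3 * exp (H * (2 * R)) * (3 * exp (H * (49 / 25 * R)) * N (7 / 5 * R))"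
      using R by (intro mult_left_mono step) auto
    also have "\<dots> \<le> 3 * exp (H * (2 * R)) * (3 * exp (H * (49 / 25 * R)) *
        (3 * exp (H * (7 / 5 * R)) * N R))"
      using R by (intro mult_left_mono step) auto
    also have "\<dots> = 27 * exp (H * (2 * R) + H * (49 / 25 * R) + H * (7 / 5 * R)) * N R"
      unfolding exp_add by (simp only: mult_ac)
    \<comment> \<open>Three steps cost 27 and the exponent 134/25, within the allowed 81 and
      13/2.\<close>
    also have "\<dots> \<le> 3 ^ 4 * exp (13 / 2 * H * R) * N R"
    proof (intro mult_right_mono mult_mono)
      have "H * (2 * R) + H * (49 / 25 * R) + H * (7 / 5 * R) = 134 / 25 * (H * R)"
        by simp
      also have "\<dots> \<le> 13 / 2 * (H * R)"
        using H R by (intro mult_right_mono) auto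
      finally show "exp (H * (2 * R) + H * (49 / 25 * R) + H * (7 / 5 * R)) \<le> exp (13 / 2 * H * R)"
        by simp
    qed (auto simp: N_def)
    finally have "N (2 * R) \<le> 3 ^ 4 * exp (13 / 2 * H * R) * N R" .
    moreover have "1 \<le> N R"
      using orbit_count_pos[OF assms(2,3) R, of x] by (simp add: N_def)
    ultimately show ?thesis
      by (simp add: N_def divide_le_eq)
  qed
qed

end
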